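(* Let $n$ be an even positive integer, and suppose a smooth function $u$ on $\mathbb{S}^n\subset\mathbb{R}^{n+1}$ depends only on $x:=x_{n+1}\in[-1,1]$. Then $$P_nu(x)=(-1)^{\frac n2}\Big[(1-x^2)^{\frac n2}u'\Big]^{(n-1)},$$ where $'$ and the superscript $(n-1)$ denote derivatives with respect to $x$.
   Context: $\mathbb{S}^n$ is the unit sphere in $\mathbb{R}^{n+1}$ with the round metric and Laplace–Beltrami operator $\Delta_{\mathbb{S}^n}$ (nonpositive). For $n$ even, the GJMS operator in critical dimension is $P_n=\prod_{j=0}^{(n-2)/2}\big(-\Delta_{\mathbb{S}^n}+j(n-1-j)\big)$. *)

theory Defs
  imports "HOL-Analysis.Analysis"
begin

text \<open>
  The unit sphere is \<open>sphere 0 1\<close> in a Euclidean space, with the metric induced by the ambient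
  inner product. Functions and vector fields on the sphere are functions on the ambient space;
  everything below, evaluated at a point of the sphere, uses only their values on the sphere.
\<close>

section \<open>Smooth functions\<close>

primrec Ck_on :: "nat \<Rightarrow> ('a::euclidean_space \<Rightarrow> real) \<Rightarrow> 'a set \<Rightarrow> bool" where
  "Ck_on 0 F U \<longleftrightarrow> continuous_on U F"
| "Ck_on (Suc k) F U \<longleftrightarrow> (\<forall>x\<in>U. F differentiable (at x)) \<and>
     (\<forall>v. Ck_on k (\<lambda>x. frechet_derivative F (at x) v) U)"

definition smooth_on_open :: "('a::euclidean_space \<Rightarrow> real) \<Rightarrow> 'a set \<Rightarrow> bool" where
  "smooth_on_open F U \<longleftrightarrow> open U \<and> (\<forall>k. Ck_on k F U)"

definition smooth_on_sphere :: "('a::euclidean_space \<Rightarrow> real) \<Rightarrow> bool" where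
  "smooth_on_sphere u \<longleftrightarrow>
     (\<forall>p\<in>sphere 0 1. \<exists>U F. p \<in> U \<and> smooth_on_open F U \<and> (\<forall>q\<in>U \<inter> sphere 0 1. F q = u q))"

section \<open>The Laplace--Beltrami operator of the round sphere\<close>

definition tangent_space :: "'a::euclidean_space \<Rightarrow> 'a set" where
  "tangent_space p = {v. v \<bullet> p = 0}"

definition tangent_proj :: "'a::euclidean_space \<Rightarrow> 'a \<Rightarrow> 'a" where
  "tangent_proj p v = v - (v \<bullet> p) *\<^sub>R p"

text \<open>
  A derivative at \<open>p\<close> within the sphere is determined on tangent vectors but arbitrary in the
  normal direction; hence this is only to be applied to \<open>v \<in> tangent_space p\<close>.
\<close>

definition sphere_differential ::
  "('a::euclidean_space \<Rightarrow> 'b::real_normed_vector) \<Rightarrow> 'a \<Rightarrow> 'a \<Rightarrow> 'b" where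
  "sphere_differential f p v = frechet_derivative f (at p within sphere 0 1) v"

definition sphere_gradient :: "('a::euclidean_space \<Rightarrow> real) \<Rightarrow> 'a \<Rightarrow> 'a" where
  "sphere_gradient u p =
     (THE g. g \<in> tangent_space p \<and> (\<forall>v\<in>tangent_space p. g \<bullet> v = sphere_differential u p v))"

text \<open>
  The Levi-Civita connection of the induced metric is the tangential part of the ambient
  derivative. In the divergence, the trace of the endomorphism \<open>\<nabla>X\<close> of \<open>tangent_space p\<close> is
  computed as the trace of its composition with the orthogonal projection, so that the standard
  basis of the ambient space can be used.
\<close>

definition sphere_connection :: "('a::euclidean_space \<Rightarrow> 'a) \<Rightarrow> 'a \<Rightarrow> 'a \<Rightarrow> 'a" where
  "sphere_connection X p v = tangent_proj p (sphere_differential X p v)"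

definition sphere_divergence :: "('a::euclidean_space \<Rightarrow> 'a) \<Rightarrow> 'a \<Rightarrow> real" where
  "sphere_divergence X p = (\<Sum>b\<in>Basis. sphere_connection X p (tangent_proj p b) \<bullet> b)"

definition sphere_laplacian :: "('a::euclidean_space \<Rightarrow> real) \<Rightarrow> 'a \<Rightarrow> real" where
  "sphere_laplacian u = sphere_divergence (sphere_gradient u)"

section \<open>The GJMS operator in critical dimension\<close>

definition gjms_factor ::
  "nat \<Rightarrow> nat \<Rightarrow> ('a::euclidean_space \<Rightarrow> real) \<Rightarrow> 'a \<Rightarrow> real" where
  "gjms_factor n j u = (\<lambda>p. - sphere_laplacian u p + real j * (real n - 1 - real j) * u p)"

text \<open>The product is composition of operators; the indices are \<open>j = 0, \<dots>, (n - 2) / 2\<close>.\<close>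

definition gjms :: "nat \<Rightarrow> ('a::euclidean_space \<Rightarrow> real) \<Rightarrow> 'a \<Rightarrow> real" where
  "gjms n = foldr (\<lambda>j T. gjms_factor n j \<circ> T) [0..<n div 2] id"

section \<open>Derivatives on \<open>[-1, 1]\<close>\<close>

text \<open>One-sided at the end points; values outside \<open>[-1, 1]\<close> are irrelevant.\<close>

definition deriv_I :: "(real \<Rightarrow> real) \<Rightarrow> real \<Rightarrow> real" where
  "deriv_I f x = vector_derivative f (at x within {-1..1})"

end

theory Submission
  imports Defs
begin

text \<open>
  Write \<open>w = 1 - x\<^sup>2\<close> and \<open>D = d/dx\<close>. On zonal functions the Laplacian is
  \<open>L\<^sub>n = w D\<^sup>2 - n x D\<close>, and \<open>D (L\<^sub>n - c) = (L\<^bsub>n+2\<^esub> - (n + c)) D\<close>. Put \<open>n = 2 m\<close> and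
  \<open>c\<^sub>j = j (n - 1 - j)\<close>. The shift \<open>c \<mapsto> n + c\<close> carries \<open>c\<^sub>0, \<dots>, c\<^bsub>m-1\<^esub>\<close> to the last \<open>m\<close> constants
  for \<open>n + 2\<close>, so the formula for \<open>n\<close>, applied to an antiderivative of \<open>L\<^bsub>n+2\<^esub> f\<close>, gives the formula
  for \<open>n + 2\<close>, because \<open>D w\<^bsup>m+1\<^esup> D = w\<^sup>m L\<^bsub>n+2\<^esub>\<close>.

  The profile \<open>f\<close> is smooth up to the end points: \<open>g(r) = f(1 - r\<^sup>2)\<close> is the restriction of \<open>u\<close> to a
  smooth curve through the pole, hence smooth and even, and
  \<open>f'(1 - r\<^sup>2) = - g'(r) / (2 r) = - 1/2 \<integral>\<^sub>0\<^sup>1 g''(t r) dt\<close> is again smooth and even in \<open>r\<close>.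
\<close>

section \<open>Functions of one variable that are differentiable several times\<close>

text \<open>Derivatives are taken within \<open>S\<close>, hence one-sided at end points. The
  existential leaves the derivative unspecified, so the closure rules hold on arbitrary sets, where
  derivatives may fail to be unique. Order 0 is unconditional; continuity comes with order
  1.\<close>

primrec ndiff :: "real set \<Rightarrow> nat \<Rightarrow> (real \<Rightarrow> real) \<Rightarrow> bool" where
  "ndiff S 0 f \<longleftrightarrow> True"
| "ndiff S (Suc k) f \<longleftrightarrow>
     (\<exists>f'. (\<forall>x\<in>S. (f has_real_derivative f' x) (at x within S)) \<and> ndiff S k f')"

definition smooth_within :: "real set \<Rightarrow> (real \<Rightarrow> real) \<Rightarrow> bool" where
  "smooth_within S f \<longleftrightarrow> (\<forall>k. ndiff S k f)"

abbreviation deriv_within :: "real set \<Rightarrow> (real \<Rightarrow> real) \<Rightarrow> real \<Rightarrow> real" where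
  "deriv_within S f x \<equiv> vector_derivative f (at x within S)"

lemma ndiff_SucI:
  assumes "\<And>x. x \<in> S \<Longrightarrow> (f has_real_derivative f' x) (at x within S)" and "ndiff S k f'"
  shows "ndiff S (Suc k) f"
  using assms by auto

lemma ndiff_SucE:
  assumes "ndiff S (Suc k) f"
  obtains f' where "\<And>x. x \<in> S \<Longrightarrow> (f has_real_derivative f' x) (at x within S)" and "ndiff S k f'"
  using assms by auto

lemma ndiff_cong:
  assumes "ndiff S k f" and eq: "\<And>x. x \<in> S \<Longrightarrow> f x = g x"
  shows "ndiff S k g"
proof (cases k)
  case (Suc j)
  then obtain f' where f': "\<And>x. x \<in> S \<Longrightarrow> (f has_real_derivative f' x) (at x within S)"
    and "ndiff S j f'"
    using assms(1) by auto
  have "(g has_real_derivative f' x) (at x within S)" if "x \<in> S" for x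
    by (rule has_field_derivative_transform_within[OF f'[OF that] zero_less_one that]) (rule eq)
  then show ?thesis using \<open>ndiff S j f'\<close> Suc by auto
qed simp

lemma ndiff_mono: "ndiff S k f \<Longrightarrow> T \<subseteq> S \<Longrightarrow> ndiff T k f"
proof (induction k arbitrary: f)
  case (Suc k)
  then obtain f' where "\<And>x. x \<in> S \<Longrightarrow> (f has_real_derivative f' x) (at x within S)"
    "ndiff S k f'" by auto
  then show ?case
    using Suc by (intro ndiff_SucI[of _ _ f']) (auto intro: DERIV_subset)
qed simp

lemma ndiff_SucD: "ndiff S (Suc k) f \<Longrightarrow> ndiff S k f"
proof (induction k arbitrary: f)
  case (Suc k)
  from Suc.prems obtain f' where "\<forall>x\<in>S. (f has_real_derivative f' x) (at x within S)"
    "ndiff S (Suc k) f'" unfolding ndiff.simps(2)[of S "Suc k"] by blast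
  then show ?case using Suc.IH by auto
qed simp

lemma ndiff_const: "ndiff S k (\<lambda>x. c)"
  by (induction k arbitrary: c) (auto intro!: exI[of _ "\<lambda>x. 0"])

lemma ndiff_ident: "ndiff S k (\<lambda>x. x)"
  by (cases k) (auto intro!: exI[of _ "\<lambda>x. 1"] ndiff_const)

lemma ndiff_add: "ndiff S k f \<Longrightarrow> ndiff S k g \<Longrightarrow> ndiff S k (\<lambda>x. f x + g x)"
proof (induction k arbitrary: f g)
  case (Suc k)
  obtain f' where "\<And>x. x \<in> S \<Longrightarrow> (f has_real_derivative f' x) (at x within S)" "ndiff S k f'"
    using ndiff_SucE[OF Suc.prems(1)] by blast
  moreover obtain g' where
    "\<And>x. x \<in> S \<Longrightarrow> (g has_real_derivative g' x) (at x within S)" "ndiff S k g'"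
    using ndiff_SucE[OF Suc.prems(2)] by blast
  ultimately show ?case
    using Suc.IH by (intro ndiff_SucI[of _ _ "\<lambda>x. f' x + g' x"]) (auto intro: DERIV_add)
qed simp

lemma ndiff_mult: "ndiff S k f \<Longrightarrow> ndiff S k g \<Longrightarrow> ndiff S k (\<lambda>x. f x * g x)"
proof (induction k arbitrary: f g)
  case (Suc k)
  obtain f' where "\<And>x. x \<in> S \<Longrightarrow> (f has_real_derivative f' x) (at x within S)" "ndiff S k f'"
    using ndiff_SucE[OF Suc.prems(1)] by blast
  moreover obtain g' where
    "\<And>x. x \<in> S \<Longrightarrow> (g has_real_derivative g' x) (at x within S)" "ndiff S k g'"
    using ndiff_SucE[OF Suc.prems(2)] by blast
  ultimately show ?case
    using Suc.IH Suc.prems[THEN ndiff_SucD]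
    by (intro ndiff_SucI[of _ _ "\<lambda>x. f' x * g x + g' x * f x"])
       (auto intro!: ndiff_add DERIV_mult)
qed simp

text \<open>Reflection carries regularity at the end point 1 over to the end point -1.\<close>

lemma ndiff_uminus_arg: "ndiff (uminus ` S) k f \<Longrightarrow> ndiff S k (\<lambda>x. f (- x))"
proof (induction k arbitrary: f)
  case (Suc k)
  then obtain f' where f': "\<And>x. x \<in> uminus ` S \<Longrightarrow> (f has_real_derivative f' x) (at x within uminus ` S)"
    and "ndiff (uminus ` S) k f'" by auto
  have "((\<lambda>x. f (- x)) has_real_derivative - 1 * f' (- x)) (at x within S)" if "x \<in> S" for x
    using DERIV_image_chain[of f "f' (- x)" uminus x S "- 1"] f'[of "- x"] that
      DERIV_minus[OF DERIV_ident, of x S]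
    by (simp add: o_def)
  then show ?case
    using Suc.IH[OF \<open>ndiff (uminus ` S) k f'\<close>]
    by (intro ndiff_SucI[of _ _ "\<lambda>x. - 1 * f' (- x)"] ndiff_mult ndiff_const) auto
qed simp

lemma deriv_within_eq:
  assumes "x islimpt S" and "(f has_real_derivative d) (at x within S)"
  shows "deriv_within S f x = d"
  using assms vector_derivative_within[of x S f d]
  by (simp add: has_real_derivative_iff_has_vector_derivative trivial_limit_within)

text \<open>At limit points of \<open>S\<close> derivatives are unique, so the local choices agree
  on overlaps and glue to \<open>deriv_within S f\<close>.\<close>

lemma ndiff_local:
  assumes "\<And>x. x \<in> S \<Longrightarrow> \<exists>T. open T \<and> x \<in> T \<and> ndiff (S \<inter> T) k f"
    and perfect: "\<And>x. x \<in> S \<Longrightarrow> x islimpt S"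
  shows "ndiff S k f"
  using assms(1)
proof (induction k arbitrary: f)
  case (Suc k)
  have *: "\<exists>T. open T \<and> x \<in> T \<and> ndiff (S \<inter> T) k (deriv_within S f) \<and>
      (f has_real_derivative deriv_within S f x) (at x within S)" if "x \<in> S" for x
  proof -
    obtain T where T: "open T" "x \<in> T" and "ndiff (S \<inter> T) (Suc k) f"
      using Suc.prems \<open>x \<in> S\<close> by blast
    then obtain f' where nd: "ndiff (S \<inter> T) k f'"
      and f': "\<And>y. y \<in> S \<inter> T \<Longrightarrow> (f has_real_derivative f' y) (at y within S \<inter> T)"
      using ndiff_SucE by blast
    have f'': "(f has_real_derivative f' y) (at y within S)" if "y \<in> S \<inter> T" for y
      using f'[OF that] at_within_nhd[of y T "S \<inter> T" S] that T by (simp add: Int_assoc)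
    have eq: "deriv_within S f y = f' y" if "y \<in> S \<inter> T" for y
      using deriv_within_eq[OF perfect f''] that by blast
    show ?thesis
      using T ndiff_cong[OF nd eq[symmetric]] f'' eq that by (intro exI[of _ T]) auto
  qed
  show ?case
    using Suc.IH[of "deriv_within S f"] * by (intro ndiff_SucI[of _ _ "deriv_within S f"]) blast+
qed simp

section \<open>Functions with derivatives of every order within a set\<close>

lemma smooth_within_const: "smooth_within S (\<lambda>x. c)"
  and smooth_within_ident: "smooth_within S (\<lambda>x. x)"
  and smooth_within_add:
    "smooth_within S f \<Longrightarrow> smooth_within S g \<Longrightarrow> smooth_within S (\<lambda>x. f x + g x)"
  and smooth_within_mult:
    "smooth_within S f \<Longrightarrow> smooth_within S g \<Longrightarrow> smooth_within S (\<lambda>x. f x * g x)"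
  unfolding smooth_within_def
  by (simp_all add: ndiff_const ndiff_ident ndiff_add ndiff_mult)

lemma smooth_within_diff:
  "smooth_within S f \<Longrightarrow> smooth_within S g \<Longrightarrow> smooth_within S (\<lambda>x. f x - g x)"
  using smooth_within_add[of S f "\<lambda>x. - 1 * g x"]
    smooth_within_mult[OF smooth_within_const[of S "-1"]] by simp

lemma smooth_within_uminus: "smooth_within S f \<Longrightarrow> smooth_within S (\<lambda>x. - f x)"
  using smooth_within_diff[OF smooth_within_const[of S 0]] by simp

lemma smooth_within_power: "smooth_within S f \<Longrightarrow> smooth_within S (\<lambda>x. f x ^ m)"
  by (induction m) (simp_all add: smooth_within_const smooth_within_mult)

lemmas smooth_within_intros = smooth_within_const smooth_within_ident smooth_within_add
  smooth_within_diff smooth_within_uminus smooth_within_mult smooth_within_power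

lemma smooth_withinI:
  assumes "\<And>x. x \<in> S \<Longrightarrow> (f has_real_derivative f' x) (at x within S)" "smooth_within S f'"
  shows "smooth_within S f"
proof -
  have "ndiff S k f" for k
    using assms by (cases k) (auto simp: smooth_within_def)
  then show ?thesis by (simp add: smooth_within_def)
qed

lemma smooth_within_DERIV:
  assumes "smooth_within S f" and perfect: "\<And>x. x \<in> S \<Longrightarrow> x islimpt S" and "x \<in> S"
  shows "(f has_real_derivative deriv_within S f x) (at x within S)"
proof -
  from assms(1) obtain f' where "\<And>x. x \<in> S \<Longrightarrow> (f has_real_derivative f' x) (at x within S)"
    unfolding smooth_within_def using ndiff.simps(2)[of S 0 f] by blast
  then show ?thesis using deriv_within_eq perfect assms(3) by metis
qed

lemma smooth_within_deriv:
  assumes "smooth_within S f" and perfect: "\<And>x. x \<in> S \<Longrightarrow> x islimpt S"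
  shows "smooth_within S (deriv_within S f)"
  unfolding smooth_within_def
proof
  fix k
  from assms(1) obtain f' where "\<And>x. x \<in> S \<Longrightarrow> (f has_real_derivative f' x) (at x within S)"
    and "ndiff S k f'"
    unfolding smooth_within_def using ndiff.simps(2)[of S k f] by blast
  then show "ndiff S k (deriv_within S f)"
    using deriv_within_eq[OF perfect] ndiff_cong by metis
qed

lemma smooth_within_continuous_on: "smooth_within S f \<Longrightarrow> continuous_on S f"
  unfolding smooth_within_def using ndiff.simps(2)[of S 0 f] DERIV_continuous_on by blast

lemma smooth_within_antideriv:
  assumes "smooth_within {a..b} g"
  shows "\<exists>G. smooth_within {a..b} G \<and>
    (\<forall>x\<in>{a..b}. (G has_real_derivative g x) (at x within {a..b}))"
  using integral_has_real_derivative[OF smooth_within_continuous_on[OF assms]] smooth_withinI assms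
  by blast

text \<open>Differentiation lowers the exponent by one and produces a linear factor, so the
  induction runs over all real exponents at once. The case \<open>s = 1 / 2\<close> parametrizes a
  circle below.\<close>

lemma smooth_within_powr:
  assumes "\<And>x. x \<in> S \<Longrightarrow> 0 < c - x\<^sup>2"
  shows "smooth_within S (\<lambda>x. (c - x\<^sup>2) powr s)"
proof -
  have "ndiff S k (\<lambda>x. (c - x\<^sup>2) powr s)" for k
  proof (induction k arbitrary: s)
    case (Suc k)
    have "((\<lambda>x. (c - x\<^sup>2) powr s) has_real_derivative (- 2 * s * x) * (c - x\<^sup>2) powr (s - 1))
        (at x within S)" if "x \<in> S" for x
    proof -
      have "((\<lambda>x. c - x\<^sup>2) has_real_derivative - 2 * x) (at x within S)"
        by (auto intro!: derivative_eq_intros)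
      from DERIV_chain2[OF has_real_derivative_powr[OF assms[OF that], of s] this]
      show ?thesis by (simp add: ac_simps)
    qed
    moreover have "ndiff S k (\<lambda>x. (- 2 * s * x) * (c - x\<^sup>2) powr (s - 1))"
      by (rule ndiff_mult[OF ndiff_mult[OF ndiff_const ndiff_ident] Suc])
    ultimately show ?case by (rule ndiff_SucI)
  qed simp
  then show ?thesis by (simp add: smooth_within_def)
qed

section \<open>Restrictions of smooth functions to curves\<close>

text \<open>By the chain rule the derivative along the curve is a combination of directional
  derivatives of \<open>F\<close> along the same curve, and these belong to the class of one order
  less.\<close>

lemma ndiff_curve:
  fixes F :: "'a::euclidean_space \<Rightarrow> real"
  assumes "Ck_on k F U"
    and "smooth_within S \<alpha>" "smooth_within S \<beta>" "\<And>x. x \<in> S \<Longrightarrow> x islimpt S"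
    and "\<And>x. x \<in> S \<Longrightarrow> \<alpha> x *\<^sub>R a + \<beta> x *\<^sub>R b \<in> U"
  shows "ndiff S k (\<lambda>x. F (\<alpha> x *\<^sub>R a + \<beta> x *\<^sub>R b))"
  using assms(1)
proof (induction k arbitrary: F)
  case (Suc k)
  let ?\<gamma> = "\<lambda>x. \<alpha> x *\<^sub>R a + \<beta> x *\<^sub>R b"
  let ?\<alpha>' = "deriv_within S \<alpha>" and ?\<beta>' = "deriv_within S \<beta>"
  let ?D = "\<lambda>x. ?\<alpha>' x * frechet_derivative F (at (?\<gamma> x)) a + ?\<beta>' x * frechet_derivative F (at (?\<gamma> x)) b"
  have "((\<lambda>x. F (?\<gamma> x)) has_real_derivative ?D x) (at x within S)" if "x \<in> S" for x
  proof -
    have F: "F differentiable at (?\<gamma> x)" using Suc.prems assms(5)[OF that] by simp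
    note lin = linear_frechet_derivative[OF F]
    have "(\<alpha> has_derivative (*) (?\<alpha>' x)) (at x within S)" "(\<beta> has_derivative (*) (?\<beta>' x)) (at x within S)"
      using smooth_within_DERIV assms(2-4) that by (auto simp: has_field_derivative_def)
    then have "(?\<gamma> has_derivative (\<lambda>h. (?\<alpha>' x * h) *\<^sub>R a + (?\<beta>' x * h) *\<^sub>R b)) (at x within S)"
      by (auto intro!: derivative_eq_intros)
    from has_derivative_compose[OF this F[unfolded frechet_derivative_works]]
    show ?thesis
      unfolding has_field_derivative_def
      by (rule has_derivative_eq_rhs)
         (simp add: fun_eq_iff linear_add[OF lin] linear_cmul[OF lin] algebra_simps)
  qed
  moreover have "ndiff S k (\<lambda>x. frechet_derivative F (at (?\<gamma> x)) v)" for v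
    using Suc.IH[of "\<lambda>y. frechet_derivative F (at y) v"] Suc.prems by simp
  then have "ndiff S k ?D"
    using smooth_within_deriv[OF assms(2)] smooth_within_deriv[OF assms(3)] assms(4)
    by (intro ndiff_add ndiff_mult) (auto simp: smooth_within_def)
  ultimately show ?case by (rule ndiff_SucI)
qed simp

section \<open>Even functions and regularity at the poles\<close>

lemma islimpt_open: "open S \<Longrightarrow> x \<in> S \<Longrightarrow> x islimpt S" for x :: real
  by (simp add: interior_limit_point interior_open)

text \<open>Differentiation under the integral gives an integral of the same shape, with
  \<open>j + 1\<close> and the derivative of \<open>\<phi>\<close>. The factor \<open>t ^ j\<close>
  is there to close this induction.\<close>

lemma smooth_within_integral_dilation:
  assumes "smooth_within {-a<..<a} \<phi>"
  shows "smooth_within {-a<..<a} (\<lambda>r. integral {0..1} (\<lambda>t. t ^ j * \<phi> (t * r)))"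
proof -
  let ?S = "{-a<..<a}"
  have mem: "t * r \<in> ?S" if "r \<in> ?S" "t \<in> {0..1}" for t r :: real
  proof -
    have "\<bar>t * r\<bar> \<le> \<bar>r\<bar>" using that by (simp add: abs_mult mult_left_le_one_le)
    then show ?thesis using that by auto
  qed
  have perfect: "x islimpt ?S" if "x \<in> ?S" for x
    using that by (intro islimpt_open) auto
  have "ndiff ?S k (\<lambda>r. integral {0..1} (\<lambda>t. t ^ j * \<phi> (t * r)))" for k
    using assms
  proof (induction k arbitrary: \<phi> j)
    case (Suc k)
    let ?\<phi>' = "deriv_within ?S \<phi>"
    have \<phi>': "smooth_within ?S ?\<phi>'" by (rule smooth_within_deriv[OF Suc.prems perfect])
    have cont: "continuous_on (?S \<times> {0..1}) (\<lambda>(r, t). t ^ i * \<psi> (t * r))"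
      if "smooth_within ?S \<psi>" for i \<psi>
      unfolding case_prod_beta
      by (intro continuous_intros continuous_on_compose2[OF smooth_within_continuous_on[OF that]])
         (use mem in auto)
    have "((\<lambda>r. integral {0..1} (\<lambda>t. t ^ j * \<phi> (t * r))) has_real_derivative
        integral {0..1} (\<lambda>t. t ^ Suc j * ?\<phi>' (t * r))) (at r within ?S)" if "r \<in> ?S" for r
    proof -
      have D: "((\<lambda>r. t ^ j * \<phi> (t * r)) has_real_derivative t ^ Suc j * ?\<phi>' (t * x)) (at x within ?S)"
        if "x \<in> ?S" "t \<in> cbox 0 1" for x t
      proof -
        have "t * x \<in> ?S" using mem that by simp
        from smooth_within_DERIV[OF Suc.prems perfect this]
        \<comment> \<open>Working within the image of \<open>?S\<close> under multiplication by
          \<open>t\<close> also covers \<open>t = 0\<close>, where the image is a single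
          point.\<close>
        have "(\<phi> has_real_derivative ?\<phi>' (t * x)) (at (t * x) within ((*) t ` ?S))"
          by (rule DERIV_subset) (use mem that in auto)
        from DERIV_image_chain[OF this, of t]
        have "((\<lambda>x. \<phi> (t * x)) has_real_derivative ?\<phi>' (t * x) * t) (at x within ?S)"
          by (auto simp: o_def intro!: derivative_eq_intros)
        from DERIV_cmult[OF this, of "t ^ j"] show ?thesis by (simp add: ac_simps)
      qed
      have "(\<lambda>t. t ^ j * \<phi> (t * x)) integrable_on cbox 0 1" if "x \<in> ?S" for x
        by (intro integrable_continuous continuous_intros
            continuous_on_compose2[OF smooth_within_continuous_on[OF Suc.prems]])
          (use mem that in auto)
      from leibniz_rule_field_derivative[OF D this _ that] cont[OF \<phi>', of "Suc j"]
      show ?thesis by (simp add: cbox_interval)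
    qed
    then show ?case using Suc.IH[OF \<phi>', of "Suc j"] by (rule ndiff_SucI)
  qed simp
  then show ?thesis by (simp add: smooth_within_def)
qed

text \<open>The induction passes from the pair \<open>f\<close>, \<open>g\<close> to the pair
  \<open>?f'\<close>, \<open>?T\<close>: the function \<open>?T\<close> is smooth on the whole
  interval and satisfies \<open>?f' (1 - r\<^sup>2) = ?T r\<close>, so the hypotheses reproduce
  themselves.\<close>

lemma ndiff_even_substitution:
  assumes "smooth_within {-a<..<a} g" and "a > 0"
    and "\<And>r. r \<in> {-a<..<a} \<Longrightarrow> f (1 - r\<^sup>2) = g r"
  shows "ndiff {1 - a\<^sup>2<..1} k f"
  using assms(1,3)
proof (induction k arbitrary: f g)
  case (Suc k)
  let ?S = "{-a<..<a}" and ?J = "{1 - a\<^sup>2<..1}"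
  let ?g' = "deriv_within ?S g" and ?g'' = "deriv_within ?S (deriv_within ?S g)"
  let ?T = "\<lambda>r. - 1 / 2 * integral {0..1} (\<lambda>t. ?g'' (t * r))"
  let ?f' = "\<lambda>x. ?T (sqrt (1 - x))"
  have perfect: "x islimpt ?S" if "x \<in> ?S" for x
    using that by (intro islimpt_open) auto
  have sm': "smooth_within ?S ?g'" and sm'': "smooth_within ?S ?g''"
    using smooth_within_deriv perfect Suc.prems(1) by blast+
  have T: "smooth_within ?S ?T"
    using smooth_within_mult[OF smooth_within_const[of _ "- 1 / 2"] smooth_within_integral_dilation[OF sm'', of 0]]
    by simp
  have D: "(h has_real_derivative deriv_within ?S h r) (at r)" if "smooth_within ?S h" "r \<in> ?S" for h r
    using smooth_within_DERIV[OF that(1) perfect that(2)] that(2) at_within_open[of r ?S] by simp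
  \<comment> \<open>The relation with \<open>f\<close> forces \<open>g\<close> to be even.\<close>
  have odd: "?g' (- r) = - ?g' r" if r: "r \<in> ?S" for r
  proof -
    have "((\<lambda>x. g (- x)) has_real_derivative - ?g' (- r)) (at r)"
      using D[OF Suc.prems(1), of "- r"] r DERIV_chain2[of g "?g' (- r)" uminus r "- 1" UNIV]
        DERIV_minus[OF DERIV_ident, of r UNIV] by simp
    then have "(g has_real_derivative - ?g' (- r)) (at r)"
    proof (rule has_field_derivative_transform_within_open)
      show "g (- x) = g x" if "x \<in> ?S" for x
        using Suc.prems(2)[of x] Suc.prems(2)[of "- x"] that by simp
    qed (use r in auto)
    then show ?thesis
      using DERIV_unique[OF D[OF Suc.prems(1) r]] by (metis minus_minus)
  qed
  \<comment> \<open>Oddness gives \<open>?g' 0 = 0\<close>, so integrating the derivative of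
    \<open>?g' (t * r)\<close> in \<open>t\<close> over \<open>{0..1}\<close> extracts the factor
    \<open>r\<close> without dividing by it.\<close>
  have g': "?g' r = - 2 * r * ?T r" if r: "r \<in> ?S" for r
  proof -
    have "((\<lambda>t. ?g' (t * r)) has_real_derivative r * ?g'' (t * r)) (at t within {0..1})"
      if "t \<in> {0..1}" for t
    proof -
      have "\<bar>t * r\<bar> \<le> \<bar>r\<bar>" using that by (simp add: abs_mult mult_left_le_one_le)
      then have "t * r \<in> ?S" using r by auto
      moreover have "((\<lambda>t. t * r) has_real_derivative r) (at t within {0..1})"
        by (auto intro!: derivative_eq_intros)
      ultimately show ?thesis
        using DERIV_chain2[OF D[OF sm'], of "\<lambda>t. t * r" t r "{0..1}"] by (simp add: mult.commute)
    qed
    then have "((\<lambda>t. r * ?g'' (t * r)) has_integral ?g' (1 * r) - ?g' (0 * r)) {0..1}"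
      by (intro fundamental_theorem_of_calculus)
        (auto simp flip: has_real_derivative_iff_has_vector_derivative)
    moreover have "?g' 0 = 0" using odd[of 0] \<open>a > 0\<close> by simp
    ultimately have "((\<lambda>t. r * ?g'' (t * r)) has_integral ?g' r) {0..1}" by simp
    from integral_unique[OF this] show ?thesis by simp
  qed
  \<comment> \<open>For nonzero \<open>r\<close>, cancel \<open>r\<close> in the formula
    \<open>g'\<close> for the odd function \<open>?g'\<close>.\<close>
  have T_even: "?T (- r) = ?T r" if "r \<in> ?S" for r
    using odd[OF that] g'[of r] g'[of "- r"] that by (cases "r = 0") auto
  have sq: "sqrt (1 - x) \<in> ?S" if "x \<in> ?J" for x
  proof -
    have "sqrt (1 - x) < a" using that \<open>a > 0\<close> by (intro real_less_lsqrt) auto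
    moreover have "0 \<le> sqrt (1 - x)" using that by simp
    then have "- a < sqrt (1 - x)" using \<open>a > 0\<close> by linarith
    ultimately show ?thesis by simp
  qed
  have fg: "f x = g (sqrt (1 - x))" if "x \<in> ?J" for x
    using Suc.prems(2)[OF sq[OF that]] that by simp
  have cont: "continuous_on ?J (\<lambda>x. h (sqrt (1 - x)))" if "smooth_within ?S h" for h
    by (intro continuous_on_compose2[OF smooth_within_continuous_on[OF that]] continuous_intros)
       (use sq in auto)
  have interior: "(f has_real_derivative ?f' x) (at x)" if x: "x \<in> ?J" "x < 1" for x
  proof -
    let ?r = "sqrt (1 - x)"
    have "?r > 0" using x by simp
    have "((\<lambda>x. sqrt (1 - x)) has_real_derivative - 1 / (2 * ?r)) (at x)"
      using x by (auto intro!: derivative_eq_intros simp: field_simps)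
    from DERIV_chain2[OF D[OF Suc.prems(1) sq[OF x(1)]] this]
    have "((\<lambda>x. g (sqrt (1 - x))) has_real_derivative ?g' ?r * (- 1 / (2 * ?r))) (at x)" .
    then have "((\<lambda>x. g (sqrt (1 - x))) has_real_derivative ?T ?r) (at x)"
      using g'[OF sq[OF x(1)]] \<open>?r > 0\<close> by simp
    then show ?thesis
      by (rule has_field_derivative_transform_within_open[where S = "{1 - a\<^sup>2<..<1}"])
         (use x fg in auto)
  qed
  have "(f has_real_derivative ?f' x) (at x within ?J)" if x: "x \<in> ?J" for x
  proof (cases "x < 1")
    case True
    then show ?thesis using interior x has_field_derivative_at_within by blast
  next
    case False
    \<comment> \<open>Any base point strictly between \<open>1 - a\<^sup>2\<close> and 1 would do;
      the midpoint is taken.\<close>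
    define b where "b = 1 - a\<^sup>2 / 2"
    have b: "b < 1" "1 - a\<^sup>2 < b" using \<open>a > 0\<close> by (simp_all add: b_def field_simps)
    then have sub: "{b..1} \<subseteq> ?J" by auto
    have x1: "x = 1" using x False by simp
    have contf: "continuous_on ?J f"
      by (rule continuous_on_eq[OF cont[OF Suc.prems(1)]]) (simp add: fg)
    \<comment> \<open>The chain rule breaks down at 1, where the square root is not differentiable.
      Instead \<open>f\<close> is recovered near 1 as the integral of the continuous function
      \<open>?f'\<close>, which yields the one-sided derivative there.\<close>
    have f: "f b + integral {b..y} ?f' = f y" if "y \<in> {b..1}" for y
    proof -
      have "(?f' has_integral f y - f b) {b..y}"
      proof (rule fundamental_theorem_of_calculus_interior)
        show "continuous_on {b..y} f"
          by (rule continuous_on_subset[OF contf]) (use that sub in auto)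
        show "(f has_vector_derivative ?f' z) (at z)" if "z \<in> {b<..<y}" for z
          using interior[of z] that \<open>y \<in> {b..1}\<close> b
          by (auto simp: has_real_derivative_iff_has_vector_derivative)
      qed (use that in auto)
      from integral_unique[OF this] show ?thesis by linarith
    qed
    have "continuous_on {b..1} ?f'" using cont[OF T] sub continuous_on_subset by blast
    then have "((\<lambda>y. f b + integral {b..y} ?f') has_real_derivative 0 + ?f' 1) (at 1 within {b..1})"
      by (rule DERIV_add[OF DERIV_const integral_has_real_derivative]) (use b in simp)
    then have "(f has_real_derivative ?f' 1) (at 1 within {b..1})"
      unfolding add_0_left
      by (rule has_field_derivative_transform_within[OF _ zero_less_one]) (use b in simp, rule f)
    moreover have "at 1 within {b..1} = at 1 within ?J"
      by (rule at_within_nhd[of _ "{b<..}"]) (use b in auto)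
    ultimately show ?thesis using x1 by simp
  qed
  moreover have "ndiff ?J k ?f'"
  proof (rule Suc.IH[OF T])
    \<comment> \<open>The square root is the absolute value of \<open>r\<close>, so negative
      \<open>r\<close> are handled by evenness.\<close>
    show "?T (sqrt (1 - (1 - r\<^sup>2))) = ?T r" if "r \<in> ?S" for r
      using T_even[OF that] by (cases "r \<ge> 0") auto
  qed
  ultimately show ?case by (rule ndiff_SucI)
qed simp

text \<open>Restricting \<open>u\<close> to a great circle through the pole \<open>e\<close>,
  parametrized so that the height is \<open>1 - r\<^sup>2\<close>, reduces the claim to the even
  substitution; the local smooth extensions of \<open>u\<close> are glued by
  \<open>ndiff_local\<close>.\<close>

lemma zonal_profile_ndiff:
  fixes u :: "'a::euclidean_space \<Rightarrow> real"
  assumes u: "smooth_on_sphere u" "\<And>p. p \<in> sphere 0 1 \<Longrightarrow> u p = f (p \<bullet> e)"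
    and e: "norm e = 1" "norm e' = 1" "e \<bullet> e' = 0"
  shows "ndiff {-1<..1} k f"
proof -
  let ?S = "{- sqrt 2<..<sqrt 2}"
  \<comment> \<open>The horizontal coordinate is a signed root of
    \<open>1 - (1 - r\<^sup>2)\<^sup>2 = r\<^sup>2 * (2 - r\<^sup>2)\<close>. Pulling out
    \<open>r\<close> makes it smooth through the pole at \<open>r = 0\<close>, and the heights fill
    \<open>{-1<..1}\<close>.\<close>
  let ?\<alpha> = "\<lambda>r::real. 1 - r\<^sup>2" and ?\<beta> = "\<lambda>r::real. r * (2 - r\<^sup>2) powr (1 / 2)"
  let ?\<gamma> = "\<lambda>r. ?\<alpha> r *\<^sub>R e + ?\<beta> r *\<^sub>R e'"
  have sq: "r\<^sup>2 < 2" if "r \<in> ?S" for r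
    using that real_sqrt_less_iff[of "r\<^sup>2" 2] by (simp add: abs_less_iff)
  have smooth: "smooth_within ?S ?\<alpha>" "smooth_within ?S ?\<beta>"
    using sq by (auto intro!: smooth_within_intros smooth_within_powr)
  have ee: "e \<bullet> e = 1" "e' \<bullet> e' = 1" "e' \<bullet> e = 0"
    using e by (simp_all add: dot_square_norm inner_commute)
  have sphere: "?\<gamma> r \<in> sphere 0 1" if "r \<in> ?S" for r
  proof -
    have "((2 - r\<^sup>2) powr (1 / 2))\<^sup>2 = 2 - r\<^sup>2"
      using sq[OF that] by (simp add: powr_half_sqrt)
    then have "?\<gamma> r \<bullet> ?\<gamma> r = (1 - r\<^sup>2)\<^sup>2 + r\<^sup>2 * (2 - r\<^sup>2)"
      by (simp add: inner_add ee e(3) power_mult_distrib flip: power2_eq_square)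
    also have "\<dots> = 1" by (simp add: power2_eq_square algebra_simps)
    finally show ?thesis by (simp add: norm_eq_1)
  qed
  have cont: "continuous_on ?S ?\<gamma>"
    using smooth[THEN smooth_within_continuous_on]
    by (rule continuous_on_add[OF continuous_on_scaleR[OF _ continuous_on_const]
          continuous_on_scaleR[OF _ continuous_on_const]])
  have "ndiff ?S j (\<lambda>r. f (1 - r\<^sup>2))" for j
  proof (rule ndiff_local)
    fix r assume r: "r \<in> ?S"
    obtain U F where U: "?\<gamma> r \<in> U" and F: "smooth_on_open F U"
      and Fu: "\<And>q. q \<in> U \<inter> sphere 0 1 \<Longrightarrow> F q = u q"
      using u(1)[unfolded smooth_on_sphere_def, rule_format, OF sphere[OF r]] by fastforce
    let ?T = "?S \<inter> ?\<gamma> -` U"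
    have T: "open ?T"
      using cont F by (intro continuous_open_preimage) (auto simp: smooth_on_open_def)
    have "smooth_within ?T ?\<alpha>" "smooth_within ?T ?\<beta>"
      using smooth ndiff_mono[of ?S _ _ ?T] unfolding smooth_within_def by blast+
    moreover have "Ck_on j F U" using F by (simp add: smooth_on_open_def)
    ultimately have "ndiff ?T j (\<lambda>r. F (?\<gamma> r))"
      by (intro ndiff_curve[of j F U]) (auto intro: islimpt_open[OF T])
    moreover have "F (?\<gamma> x) = f (1 - x\<^sup>2)" if "x \<in> ?T" for x
    proof -
      have "F (?\<gamma> x) = f (?\<gamma> x \<bullet> e)"
        using that Fu[of "?\<gamma> x"] u(2) sphere[of x] by auto
      then show ?thesis by (simp add: inner_add_left ee)
    qed
    ultimately have "ndiff (?S \<inter> ?T) j (\<lambda>r. f (1 - r\<^sup>2))"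
      using ndiff_cong by (metis (no_types, lifting) Int_absorb1 Int_lower1)
    then show "\<exists>T. open T \<and> r \<in> T \<and> ndiff (?S \<inter> T) j (\<lambda>r. f (1 - r\<^sup>2))"
      using T r U by blast
  qed (auto intro!: islimpt_open)
  then show ?thesis
    using ndiff_even_substitution[of "sqrt 2" "\<lambda>r. f (1 - r\<^sup>2)" f k] by (simp add: smooth_within_def)
qed

lemma islimpt_Icc: "a < b \<Longrightarrow> x \<in> {a..b} \<Longrightarrow> x islimpt {a..b}" for x :: real
  by (rule connected_imp_perfect) auto

text \<open>The other pole is reached by symmetry: \<open>u\<close> is also zonal about
  \<open>- e\<close>, with profile \<open>f (- x)\<close>. The two half-open intervals are
  relatively open in \<open>{-1..1}\<close> and cover it.\<close>

lemma zonal_profile_smooth: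
  fixes u :: "'a::euclidean_space \<Rightarrow> real"
  assumes u: "smooth_on_sphere u" "\<And>p. p \<in> sphere 0 1 \<Longrightarrow> u p = f (p \<bullet> e)"
    and e: "norm e = 1" "norm e' = 1" "e \<bullet> e' = 0"
  shows "smooth_within {-1..1} f"
  unfolding smooth_within_def
proof
  fix k
  have right: "ndiff {-1<..1} k f" by (rule zonal_profile_ndiff[OF assms])
  have "ndiff {-1<..1} k (\<lambda>x. f (- x))"
    using u e by (intro zonal_profile_ndiff[of u _ "- e" e']) auto
  then have left: "ndiff {-1..<1} k f"
    using ndiff_uminus_arg[of "{-1..<1}" k "\<lambda>x. f (- x)"] by simp
  show "ndiff {-1..1} k f"
  proof (rule ndiff_local)
    fix x :: real assume "x \<in> {-1..1}"
    moreover have "{-1..1} \<inter> {-1<..} = {-1<..1::real}" "{-1..1} \<inter> {..<1} = {-1..<1::real}"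
      by auto
    ultimately show "\<exists>T. open T \<and> x \<in> T \<and> ndiff ({-1..1} \<inter> T) k f"
      using left right
      by (cases "x < 1") (auto intro: exI[of _ "{..<1}"] exI[of _ "{-1<..}"])
  qed (simp add: islimpt_Icc)
qed

section \<open>The Laplacian of a zonal function\<close>

text \<open>Derivatives within the sphere are not unique in the normal direction. Composed with the
  unit-speed great circle through \<open>p\<close> in the direction of \<open>v\<close>, any two
  become derivatives on the real line at 0, which are unique.\<close>

lemma sphere_differential_eq:
  fixes f :: "'a::euclidean_space \<Rightarrow> 'b::real_normed_vector"
  assumes p: "p \<in> sphere 0 1" and v: "v \<in> tangent_space p"
    and D: "(f has_derivative D) (at p within sphere 0 1)"
  shows "sphere_differential f p v = D v"
proof (cases "v = 0")
  case False
  let ?D = "frechet_derivative f (at p within sphere 0 1)"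
  define w where "w = v /\<^sub>R norm v"
  let ?c = "\<lambda>t. cos t *\<^sub>R p + sin t *\<^sub>R w"
  have D': "(f has_derivative ?D) (at p within sphere 0 1)"
    using D by (metis differentiableI frechet_derivative_works)
  have pw: "p \<bullet> p = 1" "w \<bullet> w = 1" "w \<bullet> p = 0" "p \<bullet> w = 0"
    using p v False
    by (auto simp: w_def tangent_space_def dot_square_norm inner_commute power2_eq_square)
  have "?c t \<bullet> ?c t = 1" for t
    by (simp add: inner_add pw flip: power2_eq_square)
  then have sub: "range ?c \<subseteq> sphere 0 1" by (auto simp: norm_eq_1)
  have c: "(?c has_derivative (\<lambda>t. t *\<^sub>R w)) (at 0)"
    by (auto intro!: derivative_eq_intros)
  have along: "((\<lambda>t. f (?c t)) has_derivative (\<lambda>t. E (t *\<^sub>R w))) (at 0)"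
    if "(f has_derivative E) (at p within sphere 0 1)" for E
    using has_derivative_in_compose[OF c, of f E] has_derivative_subset[OF that sub] by simp
  have "E v = norm v *\<^sub>R E (1 *\<^sub>R w)" if "(f has_derivative E) (at p within sphere 0 1)" for E
    using linear_cmul[OF has_derivative_linear[OF that], of "norm v" w] False by (simp add: w_def)
  moreover have "?D (1 *\<^sub>R w) = D (1 *\<^sub>R w)"
    using has_derivative_unique[OF along[OF D'] along[OF D]] by metis
  ultimately show ?thesis using D D' by (metis sphere_differential_def)
next
  case True
  have "(f has_derivative frechet_derivative f (at p within sphere 0 1)) (at p within sphere 0 1)"
    using D by (metis differentiableI frechet_derivative_works)
  then show ?thesis
    using True D by (simp add: sphere_differential_def linear_0 has_derivative_linear)
qed

section \<open>Gradient and Laplacian of functions of the height\<close>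

lemma inner_sphere_bounds:
  assumes "p \<in> sphere 0 1" "norm e = 1"
  shows "p \<bullet> e \<in> {-1..1}"
  using Cauchy_Schwarz_ineq2[of p e] assms by (simp add: abs_le_iff)

lemma has_derivative_zonal:
  fixes e :: "'a::euclidean_space"
  assumes "p \<in> sphere 0 1" "norm e = 1"
    and "(h has_real_derivative d) (at (p \<bullet> e) within {-1..1})"
  shows "((\<lambda>q. h (q \<bullet> e)) has_derivative (\<lambda>v. d * (v \<bullet> e))) (at p within sphere 0 1)"
proof -
  have "((\<lambda>q. q \<bullet> e) has_derivative (\<lambda>v. v \<bullet> e)) (at p within sphere 0 1)"
    by (auto intro!: derivative_eq_intros)
  moreover have "(\<lambda>q. q \<bullet> e) ` sphere 0 1 \<subseteq> {-1..1}"
    using inner_sphere_bounds assms(2) by blast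
  ultimately show ?thesis
    using has_derivative_in_compose[of "\<lambda>q. q \<bullet> e" "\<lambda>v. v \<bullet> e"]
      has_derivative_subset[OF assms(3)[unfolded has_field_derivative_def]] by blast
qed

text \<open>The vector is \<open>d\<close> times the tangential part of \<open>e\<close>. Uniqueness
  holds because the difference of two candidates is tangent and therefore orthogonal to
  itself.\<close>

lemma sphere_gradient_zonal:
  fixes u :: "'a::euclidean_space \<Rightarrow> real"
  assumes p: "p \<in> sphere 0 1" and e: "norm e = 1"
    and u: "\<And>q. q \<in> sphere 0 1 \<Longrightarrow> u q = h (q \<bullet> e)"
    and h: "(h has_real_derivative d) (at (p \<bullet> e) within {-1..1})"
  shows "sphere_gradient u p = d *\<^sub>R (e - (p \<bullet> e) *\<^sub>R p)"
  unfolding sphere_gradient_def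
proof (rule the_equality)
  have "(u has_derivative (\<lambda>v. d * (v \<bullet> e))) (at p within sphere 0 1)"
    by (rule has_derivative_transform[OF p u has_derivative_zonal[OF p e h]])
  then have D: "sphere_differential u p v = d * (v \<bullet> e)" if "v \<in> tangent_space p" for v
    using sphere_differential_eq[OF p that] by blast
  have pp: "p \<bullet> p = 1" using p by (simp add: dot_square_norm)
  let ?g = "d *\<^sub>R (e - (p \<bullet> e) *\<^sub>R p)"
  show g: "?g \<in> tangent_space p \<and> (\<forall>v\<in>tangent_space p. ?g \<bullet> v = sphere_differential u p v)"
    by (auto simp: D tangent_space_def inner_diff pp inner_commute)
  fix g'
  assume g': "g' \<in> tangent_space p \<and> (\<forall>v\<in>tangent_space p. g' \<bullet> v = sphere_differential u p v)"
  have "g' - ?g \<in> tangent_space p"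
    using g g' by (simp add: tangent_space_def inner_diff_left)
  then have "(g' - ?g) \<bullet> (g' - ?g) = 0"
    using g g' by (simp add: inner_diff_left del: inner_eq_zero_iff)
  then show "g' = ?g" by simp
qed

text \<open>The second-order term comes from the squared length \<open>1 - x\<^sup>2\<close> of the
  tangential part of \<open>e\<close>; the first-order term is \<open>- x * h' x\<close> times the
  trace of the tangential projection, which is the dimension of the sphere.\<close>

lemma sphere_laplacian_zonal:
  fixes u :: "'a::euclidean_space \<Rightarrow> real"
  assumes p: "p \<in> sphere 0 1" and e: "norm e = 1"
    and u: "\<And>q. q \<in> sphere 0 1 \<Longrightarrow> u q = h (q \<bullet> e)"
    and h: "\<And>x. x \<in> {-1..1} \<Longrightarrow> (h has_real_derivative h' x) (at x within {-1..1})"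
    and h': "\<And>x. x \<in> {-1..1} \<Longrightarrow> (h' has_real_derivative h'' x) (at x within {-1..1})"
  defines "x \<equiv> p \<bullet> e"
  shows "sphere_laplacian u p = (1 - x\<^sup>2) * h'' x - (real DIM('a) - 1) * x * h' x"
proof -
  have pp: "p \<bullet> p = 1" and ee: "e \<bullet> e = 1" and ep: "e \<bullet> p = x"
    using p e by (simp_all add: dot_square_norm x_def inner_commute)
  \<comment> \<open>\<open>?X\<close> extends the formula for the gradient to the ambient space,
    where the product rule gives its derivative \<open>?D\<close> at \<open>p\<close>.\<close>
  let ?X = "\<lambda>q. h' (q \<bullet> e) *\<^sub>R (e - (q \<bullet> e) *\<^sub>R q)"
  let ?D = "\<lambda>v. h' x *\<^sub>R (- ((v \<bullet> e) *\<^sub>R p) - x *\<^sub>R v) + (h'' x * (v \<bullet> e)) *\<^sub>R (e - x *\<^sub>R p)"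
  have "((\<lambda>q. h' (q \<bullet> e)) has_derivative (\<lambda>v. h'' x * (v \<bullet> e))) (at p within sphere 0 1)"
    using has_derivative_zonal[OF p e] h' inner_sphere_bounds[OF p e] by (simp add: x_def)
  then have "(?X has_derivative ?D) (at p within sphere 0 1)"
    by (auto intro!: derivative_eq_intros simp: x_def fun_eq_iff algebra_simps)
  then have X: "(sphere_gradient u has_derivative ?D) (at p within sphere 0 1)"
    by (rule has_derivative_transform[OF p, rotated])
       (use sphere_gradient_zonal[where u = u, OF _ e u h] inner_sphere_bounds[OF _ e] in simp)
  have "sphere_connection (sphere_gradient u) p (tangent_proj p b) \<bullet> b =
      h'' x * ((e \<bullet> b) * (e \<bullet> b) - 2 * x * ((p \<bullet> b) * (e \<bullet> b)) + x\<^sup>2 * ((p \<bullet> b) * (p \<bullet> b)))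
      - x * h' x * (1 - (p \<bullet> b) * (p \<bullet> b))" if "b \<in> Basis" for b
  proof -
    let ?t = "tangent_proj p b"
    have t: "?t \<bullet> p = 0"
      by (simp add: tangent_proj_def inner_diff_left pp)
    then have "sphere_connection (sphere_gradient u) p ?t = tangent_proj p (?D ?t)"
      using sphere_differential_eq[OF p _ X, of ?t]
      by (simp add: sphere_connection_def tangent_space_def)
    \<comment> \<open>The projection kills the multiple of \<open>p\<close> and fixes the tangent
      vectors \<open>?t\<close> and \<open>e - x *\<^sub>R p\<close>.\<close>
    also have "\<dots> = (h'' x * (?t \<bullet> e)) *\<^sub>R (e - x *\<^sub>R p) - (x * h' x) *\<^sub>R ?t"
      unfolding tangent_proj_def[of p "?D ?t"]
      by (simp add: t pp ep inner_add_left inner_diff_left algebra_simps)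
    finally have conn: "sphere_connection (sphere_gradient u) p ?t =
        (h'' x * (?t \<bullet> e)) *\<^sub>R (e - x *\<^sub>R p) - (x * h' x) *\<^sub>R ?t" .
    have b: "b \<bullet> b = 1" "b \<bullet> p = p \<bullet> b" "b \<bullet> e = e \<bullet> b"
      using that by (simp_all add: inner_commute)
    show ?thesis
      unfolding conn
      by (simp add: tangent_proj_def inner_diff_left b x_def[symmetric] power2_eq_square algebra_simps)
  qed
  then have "sphere_laplacian u p =
      (\<Sum>b\<in>Basis. h'' x * ((e \<bullet> b) * (e \<bullet> b) - 2 * x * ((p \<bullet> b) * (e \<bullet> b)) + x\<^sup>2 * ((p \<bullet> b) * (p \<bullet> b)))
      - x * h' x * (1 - (p \<bullet> b) * (p \<bullet> b)))"
    by (simp add: sphere_laplacian_def sphere_divergence_def)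
  \<comment> \<open>The sums of products of coordinates are inner products, and the constant 1
    contributes the ambient dimension.\<close>
  also have "\<dots> = h'' x * (e \<bullet> e - 2 * x * (p \<bullet> e) + x\<^sup>2 * (p \<bullet> p)) - x * h' x * (real DIM('a) - p \<bullet> p)"
    by (simp add: sum_subtractf sum.distrib flip: sum_distrib_left euclidean_inner)
  also have "\<dots> = (1 - x\<^sup>2) * h'' x - (real DIM('a) - 1) * x * h' x"
    by (simp add: pp ee x_def[symmetric] power2_eq_square algebra_simps)
  finally show ?thesis .
qed

section \<open>Factorization of the one-dimensional operator\<close>

abbreviation smooth_I :: "(real \<Rightarrow> real) \<Rightarrow> bool" where
  "smooth_I \<equiv> smooth_within {-1..1}"

lemma islimpt_I: "x \<in> {-1..1} \<Longrightarrow> x islimpt {-1..1}" for x :: real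
  by (rule islimpt_Icc) auto

section \<open>Calculus of \<open>deriv_I\<close> on smooth profiles\<close>

lemma deriv_I_eq:
  "x \<in> {-1..1} \<Longrightarrow> (f has_real_derivative d) (at x within {-1..1}) \<Longrightarrow> deriv_I f x = d"
  unfolding deriv_I_def by (intro deriv_within_eq islimpt_I)

lemma DERIV_deriv_I:
  "smooth_I f \<Longrightarrow> x \<in> {-1..1} \<Longrightarrow> (f has_real_derivative deriv_I f x) (at x within {-1..1})"
  unfolding deriv_I_def using smooth_within_DERIV islimpt_I by blast

lemma smooth_I_deriv: "smooth_I f \<Longrightarrow> smooth_I (deriv_I f)"
  unfolding deriv_I_def using smooth_within_deriv islimpt_I by blast

lemma smooth_I_funpow_deriv: "smooth_I f \<Longrightarrow> smooth_I ((deriv_I ^^ k) f)"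
  by (induction k) (simp_all add: smooth_I_deriv)

lemma deriv_I_cong:
  assumes "smooth_I f" "\<And>x. x \<in> {-1..1} \<Longrightarrow> f x = g x" "x \<in> {-1..1}"
  shows "deriv_I f x = deriv_I g x"
  using has_field_derivative_transform_within[OF DERIV_deriv_I[OF assms(1,3)] zero_less_one assms(3,2)]
    deriv_I_eq[OF assms(3)] by metis

lemma funpow_deriv_I_cong:
  assumes "smooth_I f" "\<And>x. x \<in> {-1..1} \<Longrightarrow> f x = g x" "x \<in> {-1..1}"
  shows "(deriv_I ^^ k) f x = (deriv_I ^^ k) g x"
  using assms(3)
proof (induction k arbitrary: x)
  case (Suc k)
  then show ?case using deriv_I_cong[OF smooth_I_funpow_deriv[OF assms(1)]] by simp
qed (simp add: assms(2))

lemma funpow_deriv_I_cmult: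
  assumes "smooth_I f" "x \<in> {-1..1}"
  shows "(deriv_I ^^ k) (\<lambda>x. c * f x) x = c * (deriv_I ^^ k) f x"
  using assms(2)
proof (induction k arbitrary: x)
  case (Suc k)
  have "deriv_I ((deriv_I ^^ k) (\<lambda>x. c * f x)) x = deriv_I (\<lambda>x. c * (deriv_I ^^ k) f x) x"
    using Suc assms(1) smooth_within_const
    by (intro deriv_I_cong smooth_I_funpow_deriv smooth_within_mult) auto
  also have "\<dots> = c * deriv_I ((deriv_I ^^ k) f) x"
    using Suc.prems by (intro deriv_I_eq DERIV_cmult DERIV_deriv_I smooth_I_funpow_deriv assms(1))
  finally show ?case by simp
qed simp

text \<open>For \<open>a = n\<close> and \<open>c = j * (n - 1 - j)\<close> this is the GJMS factor
  acting on profiles. The parameter \<open>a\<close> stays free because differentiation changes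
  it.\<close>

definition zonal_factor :: "real \<Rightarrow> real \<Rightarrow> (real \<Rightarrow> real) \<Rightarrow> real \<Rightarrow> real" where
  "zonal_factor a c f = (\<lambda>x. - ((1 - x\<^sup>2) * deriv_I (deriv_I f) x - a * x * deriv_I f x) + c * f x)"

definition zonal_prod :: "real \<Rightarrow> real list \<Rightarrow> (real \<Rightarrow> real) \<Rightarrow> real \<Rightarrow> real" where
  "zonal_prod a = foldr (zonal_factor a)"

section \<open>The operators on profiles and their products\<close>

lemma zonal_prod_simps [simp]:
  "zonal_prod a [] f = f" "zonal_prod a (c # cs) f = zonal_factor a c (zonal_prod a cs f)"
  by (simp_all add: zonal_prod_def)

lemma smooth_I_zonal_factor: "smooth_I f \<Longrightarrow> smooth_I (zonal_factor a c f)"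
  unfolding zonal_factor_def by (intro smooth_within_intros smooth_I_deriv)

lemma smooth_I_zonal_prod: "smooth_I f \<Longrightarrow> smooth_I (zonal_prod a cs f)"
  by (induction cs) (simp_all add: smooth_I_zonal_factor)

lemma zonal_factor_cong:
  assumes "smooth_I f" "\<And>x. x \<in> {-1..1} \<Longrightarrow> f x = g x" "x \<in> {-1..1}"
  shows "zonal_factor a c f x = zonal_factor a c g x"
  using assms deriv_I_cong[OF assms(1,2)] deriv_I_cong[OF smooth_I_deriv[OF assms(1)]]
  by (simp add: zonal_factor_def)

lemma zonal_prod_cong:
  assumes "smooth_I f" "\<And>x. x \<in> {-1..1} \<Longrightarrow> f x = g x" "x \<in> {-1..1}"
  shows "zonal_prod a cs f x = zonal_prod a cs g x"
  using assms(3)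
proof (induction cs arbitrary: x)
  case (Cons c cs)
  then show ?case using zonal_factor_cong[OF smooth_I_zonal_prod[OF assms(1)]] by simp
qed (simp add: assms(2))

text \<open>Differentiating \<open>1 - x\<^sup>2\<close> adds 2 to the drift coefficient
  \<open>a\<close>; differentiating \<open>a * x\<close> adds \<open>a\<close> to the
  constant.\<close>

lemma deriv_zonal_factor:
  assumes "smooth_I f" "x \<in> {-1..1}"
  shows "deriv_I (zonal_factor a c f) x = zonal_factor (a + 2) (a + c) (deriv_I f) x"
proof -
  note D = DERIV_deriv_I[OF _ assms(2)]
  show ?thesis
    unfolding zonal_factor_def
    by (rule deriv_I_eq[OF assms(2)])
       (auto intro!: derivative_eq_intros D assms smooth_I_deriv simp: algebra_simps)
qed

lemma deriv_zonal_prod: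
  assumes "smooth_I f" "x \<in> {-1..1}"
  shows "deriv_I (zonal_prod a cs f) x = zonal_prod (a + 2) (map ((+) a) cs) (deriv_I f) x"
  using assms(2)
proof (induction cs arbitrary: x)
  case (Cons c cs)
  have "deriv_I (zonal_prod a (c # cs) f) x =
      zonal_factor (a + 2) (a + c) (deriv_I (zonal_prod a cs f)) x"
    using deriv_zonal_factor smooth_I_zonal_prod assms(1) Cons.prems by simp
  also have "\<dots> = zonal_prod (a + 2) (map ((+) a) (c # cs)) (deriv_I f) x"
    using zonal_factor_cong[OF smooth_I_deriv[OF smooth_I_zonal_prod[OF assms(1)]]] Cons by simp
  finally show ?case .
qed simp

text \<open>The two factors differ by a multiple of the identity. The proof expands both sides into
  derivatives of \<open>f\<close> up to order four.\<close>

lemma zonal_factor_commute: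
  assumes "smooth_I f" "x \<in> {-1..1}"
  shows "zonal_factor a c (zonal_factor a d f) x = zonal_factor a d (zonal_factor a c f) x"
proof -
  \<comment> \<open>Intertwining twice shifts the constant first by \<open>a\<close>, then by
    \<open>a + 2\<close>.\<close>
  have "deriv_I (deriv_I (zonal_factor a b f)) x =
      zonal_factor (a + 4) (a + 2 + (a + b)) (deriv_I (deriv_I f)) x" for b
  proof -
    have "deriv_I (deriv_I (zonal_factor a b f)) x
        = deriv_I (zonal_factor (a + 2) (a + b) (deriv_I f)) x"
      using deriv_zonal_factor assms
      by (intro deriv_I_cong smooth_I_deriv smooth_I_zonal_factor) auto
    then show ?thesis
      using deriv_zonal_factor[OF smooth_I_deriv[OF assms(1)] assms(2), of "a + 2" "a + b"]
      by (simp add: add.assoc)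
  qed
  then show ?thesis
    unfolding zonal_factor_def[of a c "zonal_factor a d f"] zonal_factor_def[of a d "zonal_factor a c f"]
    by (simp add: deriv_zonal_factor[OF assms]) (simp add: zonal_factor_def algebra_simps)
qed

lemma zonal_factor_prod_commute:
  assumes "smooth_I f" "x \<in> {-1..1}"
  shows "zonal_factor a c (zonal_prod a cs f) x = zonal_prod a cs (zonal_factor a c f) x"
  using assms(2)
proof (induction cs arbitrary: x)
  case (Cons d cs)
  have "zonal_factor a c (zonal_prod a (d # cs) f) x
      = zonal_factor a d (zonal_factor a c (zonal_prod a cs f)) x"
    using zonal_factor_commute smooth_I_zonal_prod assms(1) Cons.prems by simp
  also have "\<dots> = zonal_prod a (d # cs) (zonal_factor a c f) x"
    using zonal_factor_cong[OF smooth_I_zonal_factor[OF smooth_I_zonal_prod[OF assms(1)]]] Cons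
    by simp
  finally show ?case .
qed simp

text \<open>The power \<open>(1 - x\<^sup>2) ^ Suc m\<close> is the integrating factor that puts the
  second-order operator with \<open>a = 2 * (m + 1)\<close> into divergence form.\<close>

lemma deriv_weighted_deriv:
  assumes "smooth_I f" "x \<in> {-1..1}"
  shows "deriv_I (\<lambda>x. (1 - x\<^sup>2) ^ Suc m * deriv_I f x) x =
    - ((1 - x\<^sup>2) ^ m * zonal_factor (2 * real (Suc m)) 0 f x)"
proof -
  have "((\<lambda>x. (1 - x\<^sup>2) ^ Suc m * deriv_I f x) has_real_derivative
      (1 - x\<^sup>2) ^ Suc m * deriv_I (deriv_I f) x
      + real (Suc m) * (1 - x\<^sup>2) ^ m * (- 2 * x) * deriv_I f x) (at x within {-1..1})"
    using DERIV_deriv_I[OF smooth_I_deriv[OF assms(1)] assms(2)]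
    by (auto intro!: derivative_eq_intros simp del: power_Suc)
  from deriv_I_eq[OF assms(2) this] show ?thesis
    by (simp add: zonal_factor_def algebra_simps)
qed

text \<open>Here \<open>n = 2 * (k + 1)\<close>, so \<open>2 * k + 1\<close> is
  \<open>n - 1\<close>. The base case is the divergence form with \<open>m = 0\<close>; the
  induction step raises \<open>n\<close> by 2.\<close>

lemma zonal_prod_eq:
  assumes "smooth_I f" "x \<in> {-1..1}"
  shows "zonal_prod (2 * real (Suc k)) (map (\<lambda>j. real j * (2 * real (Suc k) - 1 - real j)) [0..<Suc k]) f x
    = (-1) ^ Suc k * (deriv_I ^^ (2 * k + 1)) (\<lambda>x. (1 - x\<^sup>2) ^ Suc k * deriv_I f x) x"
  using assms
proof (induction k arbitrary: f x)
  case 0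
  then show ?case using deriv_weighted_deriv[OF 0, of 0] by simp
next
  case (Suc k)
  let ?m = "Suc k"
  let ?c = "\<lambda>m j. real j * (2 * real m - 1 - real j)"
  let ?cs = "map (?c ?m) [0..<?m]"
  define g where "g = zonal_factor (2 * real (Suc ?m)) 0 f"
  have g: "smooth_I g" unfolding g_def by (rule smooth_I_zonal_factor[OF Suc.prems(1)])
  \<comment> \<open>The induction hypothesis is applied to \<open>G\<close>: its weighted derivative
    is \<open>?w g\<close>, which equals minus the derivative of \<open>?h\<close>.\<close>
  obtain G where G: "smooth_I G"
    and "\<And>x. x \<in> {-1..1} \<Longrightarrow> (G has_real_derivative g x) (at x within {-1..1})"
    using smooth_within_antideriv[OF g] by blast
  then have Gg: "deriv_I G y = g y" if "y \<in> {-1..1}" for y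
    using deriv_I_eq that by blast
  \<comment> \<open>The index \<open>j = 0\<close> gives the constant 0, and with
    \<open>m = ?m\<close> the others satisfy
    \<open>(j + 1) * (2 * m - j) = 2 * m + j * (2 * m - 1 - j)\<close>.\<close>
  have cs: "map (?c (Suc ?m)) [0..<Suc ?m] = 0 # map ((+) (2 * real ?m)) ?cs"
  proof -
    have "[0..<Suc ?m] = 0 # map Suc [0..<?m]" by (simp add: upt_conv_Cons map_Suc_upt del: upt_Suc)
    then show ?thesis by (simp add: algebra_simps del: upt_Suc)
  qed
  have a: "2 * real (Suc ?m) = 2 * real ?m + 2" by simp
  let ?w = "\<lambda>f x. (1 - x\<^sup>2) ^ ?m * f x"
  let ?h = "\<lambda>x. (1 - x\<^sup>2) ^ Suc ?m * deriv_I f x"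
  have sm_h: "smooth_I ?h" by (intro smooth_within_intros smooth_I_deriv Suc.prems(1))
  \<comment> \<open>The factor with constant 0 is moved from the outermost to the innermost place,
    where it turns \<open>f\<close> into \<open>g\<close>.\<close>
  have "zonal_prod (2 * real (Suc ?m)) (map (?c (Suc ?m)) [0..<Suc ?m]) f x
      = zonal_prod (2 * real (Suc ?m)) (map ((+) (2 * real ?m)) ?cs) g x"
    unfolding cs zonal_prod_simps g_def by (rule zonal_factor_prod_commute[OF Suc.prems])
  also have "\<dots> = zonal_prod (2 * real ?m + 2) (map ((+) (2 * real ?m)) ?cs) (deriv_I G) x"
    unfolding a using Gg by (intro zonal_prod_cong[OF g _ Suc.prems(2)]) simp
  also have "\<dots> = deriv_I (zonal_prod (2 * real ?m) ?cs G) x"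
    by (rule deriv_zonal_prod[OF G Suc.prems(2), symmetric])
  also have "\<dots> = deriv_I (\<lambda>x. (-1) ^ ?m * (deriv_I ^^ (2 * k + 1)) (?w (deriv_I G)) x) x"
    by (rule deriv_I_cong[OF smooth_I_zonal_prod[OF G] Suc.IH[OF G] Suc.prems(2)])
  also have "\<dots> = (-1) ^ ?m * deriv_I ((deriv_I ^^ (2 * k + 1)) (?w (deriv_I G))) x"
    using funpow_deriv_I_cmult[of "(deriv_I ^^ (2 * k + 1)) (?w (deriv_I G))" x 1] Suc.prems(2)
      smooth_I_funpow_deriv[of "?w (deriv_I G)"] G
    by (simp add: smooth_within_intros smooth_I_deriv del: power_Suc)
  also have "\<dots> = (-1) ^ ?m * (deriv_I ^^ (2 * k + 2)) (?w (deriv_I G)) x"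
    by simp
  \<comment> \<open>The divergence form supplies the extra sign and one more derivative, which
    completes the order \<open>2 * Suc k + 1\<close>.\<close>
  also have "(deriv_I ^^ (2 * k + 2)) (?w (deriv_I G)) x
      = (deriv_I ^^ (2 * k + 2)) (\<lambda>x. -1 * deriv_I ?h x) x"
    using Gg deriv_weighted_deriv[OF Suc.prems(1), of _ ?m]
    by (intro funpow_deriv_I_cong[OF _ _ Suc.prems(2)] smooth_within_intros smooth_I_deriv G)
       (simp add: g_def del: power_Suc)
  also have "\<dots> = -1 * (deriv_I ^^ (2 * k + 2)) (deriv_I ?h) x"
    by (rule funpow_deriv_I_cmult[OF smooth_I_deriv[OF sm_h] Suc.prems(2)])
  also have "(deriv_I ^^ (2 * k + 2)) (deriv_I ?h) x = (deriv_I ^^ (2 * Suc k + 1)) ?h x"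
    using funpow_Suc_right[of "2 * k + 2" deriv_I] by (simp add: o_def)
  finally show ?case by simp
qed

section \<open>The GJMS operator on zonal functions\<close>

text \<open>After each factor the result is again zonal on the sphere with a smooth profile, so the
  Laplacian formula applies to the next factor; \<open>DIM('a) - 1 = n\<close> becomes the parameter
  \<open>a\<close>.\<close>

lemma gjms_factors_zonal:
  fixes u :: "'a::euclidean_space \<Rightarrow> real"
  assumes n: "DIM('a) = n + 1" and e: "norm e = 1" and f: "smooth_I f"
    and u: "\<And>q. q \<in> sphere 0 1 \<Longrightarrow> u q = f (q \<bullet> e)"
    and p: "p \<in> sphere 0 1"
  shows "foldr (\<lambda>j T. gjms_factor n j \<circ> T) js id u p =
    zonal_prod (real n) (map (\<lambda>j. real j * (real n - 1 - real j)) js) f (p \<bullet> e)"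
  using p
proof (induction js arbitrary: p)
  case (Cons j js)
  let ?F = "zonal_prod (real n) (map (\<lambda>j. real j * (real n - 1 - real j)) js) f"
  let ?U = "foldr (\<lambda>j T. gjms_factor n j \<circ> T) js id u"
  have F: "smooth_I ?F" by (rule smooth_I_zonal_prod[OF f])
  have laplacian: "sphere_laplacian ?U p =
      (1 - (p \<bullet> e)\<^sup>2) * deriv_I (deriv_I ?F) (p \<bullet> e)
      - (real DIM('a) - 1) * (p \<bullet> e) * deriv_I ?F (p \<bullet> e)"
    by (rule sphere_laplacian_zonal[OF Cons.prems e Cons.IH DERIV_deriv_I[OF F]
          DERIV_deriv_I[OF smooth_I_deriv[OF F]]])
  have "foldr (\<lambda>j T. gjms_factor n j \<circ> T) (j # js) id u p = gjms_factor n j ?U p"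
    by (simp only: foldr.simps comp_apply)
  also have "\<dots> = zonal_factor (real n) (real j * (real n - 1 - real j)) ?F (p \<bullet> e)"
    unfolding gjms_factor_def laplacian Cons.IH[OF Cons.prems] by (simp add: zonal_factor_def n)
  finally show ?case by (simp only: list.map zonal_prod_simps)
qed (simp add: u)

theorem proposition1:
  fixes n :: nat and l :: "'m::finite"
    and u :: "real ^ 'm \<Rightarrow> real" and f :: "real \<Rightarrow> real"
  assumes "n > 0" and "even n" and "CARD('m) = n + 1"
    and "smooth_on_sphere u"
    and "\<And>p. p \<in> sphere 0 1 \<Longrightarrow> u p = f (p $ l)"
  shows "\<forall>p \<in> sphere 0 1. gjms n u p =
    (-1) ^ (n div 2) * (deriv_I ^^ (n - 1)) (\<lambda>x. (1 - x\<^sup>2) ^ (n div 2) * deriv_I f x) (p $ l)"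
proof
  fix p :: "real ^ 'm" assume p: "p \<in> sphere 0 1"
  obtain k where k: "n = 2 * Suc k"
    using assms(1,2) by (metis dvdE mult_0_right not0_implies_Suc not_less_zero)
  let ?e = "axis l 1 :: real ^ 'm"
  have e: "norm ?e = 1" by simp
  have comp: "q $ l = q \<bullet> ?e" for q by (simp add: inner_axis)
  note u = assms(5)[unfolded comp]
  \<comment> \<open>There are at least two coordinates, so a second axis is available as the
    direction \<open>e'\<close> spanning the great circle.\<close>
  have "card (UNIV - {l}) \<noteq> 0" using assms(1,3) by simp
  then obtain l' where "l' \<noteq> l" by (metis Diff_eq_empty_iff card.empty insertI1 subset_iff)
  then have "smooth_I f"
    using zonal_profile_smooth[OF assms(4) u e, of "axis l' 1"] by (simp add: inner_axis_axis)
  then have "gjms n u p = zonal_prod (real n) (map (\<lambda>j. real j * (real n - 1 - real j)) [0..<n div 2]) f (p \<bullet> ?e)"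
    unfolding gjms_def using assms(3) e u p by (intro gjms_factors_zonal) auto
  also have "\<dots> = (-1) ^ (n div 2) * (deriv_I ^^ (n - 1)) (\<lambda>x. (1 - x\<^sup>2) ^ (n div 2) * deriv_I f x) (p \<bullet> ?e)"
    using zonal_prod_eq[OF \<open>smooth_I f\<close> inner_sphere_bounds[OF p e], of k]
    by (simp add: k del: upt_Suc power_Suc)
  finally show "gjms n u p =
    (-1) ^ (n div 2) * (deriv_I ^^ (n - 1)) (\<lambda>x. (1 - x\<^sup>2) ^ (n div 2) * deriv_I f x) (p $ l)"
    by (simp add: comp)
qed

end
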